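(* Let $(\Gamma,S)$ be a Cayley graph of a group $\Gamma$ with finite generating set $S$, and suppose that for some $D\ge 3$ and some constant $C>0$ one has $V(r)\ge C r^{D}$ for all integers $r\ge 1$. Let $1\le p<D$ and $q>\frac{Dp}{D-p}$. Let $$\mathcal{S}:=\inf\left\{\|u\|_{D^{1,p}}^{p} : u\in D^{1,p}(\Gamma),\ \|u\|_{q}=1\right\},$$ and let $\{u_n\}\subset D^{1,p}(\Gamma)$ be a minimizing sequence, i.e. $\|u_n\|_q=1$ for all $n$ and $\|u_n\|_{D^{1,p}}^p\to\mathcal{S}$. Then there exists a sequence $\{g_n\}\subset\Gamma$ such that the sequence of translates $v_n(g):=u_n(g_ng)$, $g\in\Gamma$, contains a subsequence that converges in $D^{1,p}(\Gamma)$ to some $v\in D^{1,p}(\Gamma)$, and $v$ is a minimizer for $\mathcal{S}$, i.e. $\|v\|_q=1$ and $\|v\|_{D^{1,p}}^p=\mathcal{S}$.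
   Context: The Cayley graph $(\Gamma,S)$ has vertex set $\Gamma$, with $x\sim y$ (for $x\neq y$) iff $y=xs$ for some $s\in S\cup S^{-1}$. $V(r)$ is the number of group elements of word length at most $r$ with respect to $S$. All functions are real-valued. $\|u\|_q=\left(\sum_{x\in\Gamma}|u(x)|^q\right)^{1/q}$, and $$\|u\|_{D^{1,p}}=\left(\sum_{x\in\Gamma}\sum_{y\sim x}|u(y)-u(x)|^p\right)^{1/p}.$$ $D^{1,p}(\Gamma)$ is the completion of the space of finitely supported functions on $\Gamma$ in this norm, regarded as a space of functions on $\Gamma$: those $u$ for which there are finitely supported $\varphi_k$ with $\varphi_k\to u$ pointwise and $\|\varphi_k-u\|_{D^{1,p}}\to0$. Under the growth hypothesis $V(r)\ge Cr^D$ it is known that the Sobolev inequality $\|u\|_{q}\le C_{p,q}\|u\|_{D^{1,p}}$ holds for all $u\in D^{1,p}(\Gamma)$, $1\le p<D$, $q\ge\frac{Dp}{D-p}$. *)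

theory Defs
  imports Complex_Main "HOL-Analysis.Infinite_Sum" "HOL-Algebra.Generated_Groups"
begin

text \<open>
  Functions on the group are total functions of type \<open>'a \<Rightarrow> real\<close>; all notions below depend
  only on their values on \<^term>\<open>carrier G\<close>.
\<close>

definition sym_gens :: "('a, 'b) monoid_scheme \<Rightarrow> 'a set \<Rightarrow> 'a set" where
  "sym_gens G S = S \<union> m_inv G ` S"

definition word_length :: "('a, 'b) monoid_scheme \<Rightarrow> 'a set \<Rightarrow> 'a \<Rightarrow> nat" where
  "word_length G S g =
     (LEAST n. \<exists>ws. length ws = n \<and> set ws \<subseteq> sym_gens G S \<and> g = foldr (mult G) ws (one G))"

definition growth :: "('a, 'b) monoid_scheme \<Rightarrow> 'a set \<Rightarrow> nat \<Rightarrow> nat" where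
  "growth G S r = card {g \<in> carrier G. word_length G S g \<le> r}"

definition cayley_adj :: "('a, 'b) monoid_scheme \<Rightarrow> 'a set \<Rightarrow> 'a \<Rightarrow> 'a \<Rightarrow> bool" where
  "cayley_adj G S x y \<longleftrightarrow>
     x \<in> carrier G \<and> y \<in> carrier G \<and> x \<noteq> y \<and> (\<exists>s \<in> sym_gens G S. y = x \<otimes>\<^bsub>G\<^esub> s)"

text \<open>
  An \<^const>\<open>infsum\<close> that does not converge has value 0, so \<open>lq_norm\<close> and \<open>D1p_norm\<close> are the
  intended norms only where the series converges. For \<open>lq_norm\<close>, the condition
  \<open>lq_norm G q u = 1\<close> already forces convergence (\<open>lq_norm_eq_1_imp_summable\<close> below).
  For \<open>D1p_norm\<close>, convergence is the predicate \<open>finite_energy\<close>, which is made part of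
  membership in \<open>D1p\<close>.
\<close>

definition lq_norm :: "('a, 'b) monoid_scheme \<Rightarrow> real \<Rightarrow> ('a \<Rightarrow> real) \<Rightarrow> real" where
  "lq_norm G q u = (\<Sum>\<^sub>\<infinity>x \<in> carrier G. \<bar>u x\<bar> powr q) powr (1 / q)"

definition local_energy ::
  "('a, 'b) monoid_scheme \<Rightarrow> 'a set \<Rightarrow> real \<Rightarrow> ('a \<Rightarrow> real) \<Rightarrow> 'a \<Rightarrow> real" where
  "local_energy G S p u x = (\<Sum>y \<in> {y. cayley_adj G S x y}. \<bar>u y - u x\<bar> powr p)"

definition finite_energy ::
  "('a, 'b) monoid_scheme \<Rightarrow> 'a set \<Rightarrow> real \<Rightarrow> ('a \<Rightarrow> real) \<Rightarrow> bool" where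
  "finite_energy G S p u \<longleftrightarrow> local_energy G S p u summable_on carrier G"

definition D1p_norm ::
  "('a, 'b) monoid_scheme \<Rightarrow> 'a set \<Rightarrow> real \<Rightarrow> ('a \<Rightarrow> real) \<Rightarrow> real" where
  "D1p_norm G S p u = (\<Sum>\<^sub>\<infinity>x \<in> carrier G. local_energy G S p u x) powr (1 / p)"

definition finitely_supported :: "('a, 'b) monoid_scheme \<Rightarrow> ('a \<Rightarrow> real) \<Rightarrow> bool" where
  "finitely_supported G u \<longleftrightarrow> finite {x \<in> carrier G. u x \<noteq> 0}"

definition D1p :: "('a, 'b) monoid_scheme \<Rightarrow> 'a set \<Rightarrow> real \<Rightarrow> ('a \<Rightarrow> real) set" where
  "D1p G S p = {u. \<exists>\<phi> :: nat \<Rightarrow> 'a \<Rightarrow> real.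
      (\<forall>k. finitely_supported G (\<phi> k)) \<and>
      (\<forall>x \<in> carrier G. (\<lambda>k. \<phi> k x) \<longlonglongrightarrow> u x) \<and>
      (\<forall>k. finite_energy G S p (\<lambda>x. \<phi> k x - u x)) \<and>
      (\<lambda>k. D1p_norm G S p (\<lambda>x. \<phi> k x - u x)) \<longlonglongrightarrow> 0}"

definition converges_in_D1p ::
  "('a, 'b) monoid_scheme \<Rightarrow> 'a set \<Rightarrow> real \<Rightarrow> (nat \<Rightarrow> 'a \<Rightarrow> real) \<Rightarrow> ('a \<Rightarrow> real) \<Rightarrow> bool" where
  "converges_in_D1p G S p w v \<longleftrightarrow>
     (\<forall>k. w k \<in> D1p G S p) \<and> v \<in> D1p G S p \<and>
     (\<lambda>k. D1p_norm G S p (\<lambda>x. w k x - v x)) \<longlonglongrightarrow> 0"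

definition sobolev_inf :: "('a, 'b) monoid_scheme \<Rightarrow> 'a set \<Rightarrow> real \<Rightarrow> real \<Rightarrow> real" where
  "sobolev_inf G S p q = Inf {D1p_norm G S p u powr p | u. u \<in> D1p G S p \<and> lq_norm G q u = 1}"

definition is_minimizer ::
  "('a, 'b) monoid_scheme \<Rightarrow> 'a set \<Rightarrow> real \<Rightarrow> real \<Rightarrow> ('a \<Rightarrow> real) \<Rightarrow> bool" where
  "is_minimizer G S p q v \<longleftrightarrow>
     v \<in> D1p G S p \<and> lq_norm G q v = 1 \<and> D1p_norm G S p v powr p = sobolev_inf G S p q"

definition is_minimizing_seq ::
  "('a, 'b) monoid_scheme \<Rightarrow> 'a set \<Rightarrow> real \<Rightarrow> real \<Rightarrow> (nat \<Rightarrow> 'a \<Rightarrow> real) \<Rightarrow> bool" where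
  "is_minimizing_seq G S p q u \<longleftrightarrow>
     (\<forall>n. u n \<in> D1p G S p \<and> lq_norm G q (u n) = 1) \<and>
     (\<lambda>n. D1p_norm G S p (u n) powr p) \<longlonglongrightarrow> sobolev_inf G S p q"

lemma lq_norm_eq_1_imp_summable:
  assumes "lq_norm G q u = 1"
  shows "(\<lambda>x. \<bar>u x\<bar> powr q) summable_on carrier G"
  using assms infsum_not_exists unfolding lq_norm_def by fastforce

end

theory Submission
  imports Defs "HOL-Complex_Analysis.Great_Picard"
begin

text \<open>
  Because \<open>q\<close> lies strictly above the critical exponent \<open>Dp/(D-p)\<close>, a function of bounded energy and
  normalized \<open>q\<close>-sum cannot be small everywhere. Quantitatively, a function \<open>u\<close> with
  \<open>\<Sum>|u|\<^sup>q = 1\<close> and \<open>|u| \<le> \<delta>\<close> satisfies \<open>1 \<le> K E(u) \<delta>\<^sup>\<eta>\<close> for some \<open>\<eta> > 0\<close>, where \<open>E\<close> is the \<open>p\<close>-energy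
  (\<open>sup_norm_lower_bound\<close>). To see this, look at a point \<open>x\<close> and take a ball around it of radius
  \<open>r \<approx> |u(x)|\<close> to the power \<open>-q/D\<close>. By the growth hypothesis the ball is so large that, since \<open>\<Sum>|u|\<^sup>q = 1\<close>, at
  least half of its points \<open>xh\<close> have \<open>|u(xh)| < |u(x)|/2\<close>; hence the values \<open>|u(x)|\<^sup>p\<close> are controlled by
  the averages of \<open>|u(xh) - u(x)|\<^sup>p\<close> over \<open>h\<close>, and their sum over \<open>x\<close> is at most a multiple of
  \<open>r\<^sup>p E(u)\<close>. Summing over dyadic radii gives a geometric series that converges exactly when
  \<open>q > Dp/(D-p)\<close>, with a little room left for the factor \<open>\<delta>\<^sup>\<eta>\<close>.

  The estimate has two consequences. With \<open>\<delta> = 1\<close> it makes the infimum \<open>I\<close> positive. For a minimizing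
  sequence, whose energies are bounded, it bounds the supremum norms from below, so that after
  translation \<open>|w\<^sub>n| \<ge> \<delta> > 0\<close> at the identity for one fixed \<open>\<delta>\<close>. The group is countable and \<open>|w\<^sub>n| \<le> 1\<close>,
  so a subsequence converges pointwise to some \<open>v \<noteq> 0\<close>.

  The Brezis--Lieb lemma, in a version for sums (\<open>Brezis_Lieb\<close>), splits both the \<open>q\<close>-sum and the
  energy of \<open>w\<^sub>n\<close> into those of \<open>v\<close> and of \<open>w\<^sub>n - v\<close>, up to errors that vanish. Write
  \<open>a = \<Sum>|v|\<^sup>q\<close> and \<open>s = p/q\<close>. Applying the definition of \<open>I\<close> to both pieces gives
  \<open>I \<ge> I a\<^sup>s + I (1 - a)\<^sup>s\<close>, which for \<open>0 < s < 1\<close>, \<open>I > 0\<close> and \<open>0 < a \<le> 1\<close> forces \<open>a = 1\<close>. Then \<open>v\<close> has energy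
  exactly \<open>I\<close>, and nothing is left for \<open>w\<^sub>n - v\<close>: the convergence is strong.

  That \<open>v\<close> and \<open>w\<^sub>n - v\<close> are competitors at all, that is, limits of finitely supported functions, holds
  for all \<open>p \<ge> 1\<close> alike by an explicit approximation: soft thresholding turns a function
  with finite \<open>q\<close>-sum into a finitely supported one, does not increase gradients, and so approximates
  every such function of finite energy in the energy norm (\<open>in_D1p_if_power_summable\<close>).
\<close>

section \<open>Sums of powers\<close>

abbreviation power_summable :: "real \<Rightarrow> 'i set \<Rightarrow> ('i \<Rightarrow> real) \<Rightarrow> bool" where
  "power_summable p A f \<equiv> (\<lambda>i. \<bar>f i\<bar> powr p) summable_on A"

abbreviation power_sum :: "real \<Rightarrow> 'i set \<Rightarrow> ('i \<Rightarrow> real) \<Rightarrow> real" where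
  "power_sum p A f \<equiv> (\<Sum>\<^sub>\<infinity>i\<in>A. \<bar>f i\<bar> powr p)"

text \<open>
  Convexity of the \<open>p\<close>-th power, with weights left free. Weights \<open>t \<rightarrow> 0\<close> give a constant near 1 in
  front of \<open>a\<close> (for the Brezis--Lieb lemma); \<open>t = 1/(k+1)\<close> adds one step to a path of length \<open>k\<close>
  with the sharp constant.
\<close>
lemma abs_add_powr_le:
  fixes a b p t :: real
  assumes p: "1 \<le> p" and t: "0 < t" "t < 1"
  shows "\<bar>a + b\<bar> powr p \<le> (1 - t) powr (1 - p) * \<bar>a\<bar> powr p + t powr (1 - p) * \<bar>b\<bar> powr p"
proof -
  have one: "s powr p \<le> s" if "0 < s" "s < 1" for s :: real
    using powr_mono'[of 1 p s] that p by simp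
  have ge1: "s powr (1 - p) \<ge> 1" if "0 < s" "s < 1" for s :: real
    using powr_mono'[of "1 - p" 0 s] that p by simp
  show ?thesis
  proof (cases "a = 0 \<or> b = 0")
    case True
    then show ?thesis
      using ge1[of t] ge1[of "1 - t"] t p mult_right_mono[of 1 _ "\<bar>a\<bar> powr p"] mult_right_mono[of 1 _ "\<bar>b\<bar> powr p"]
      by auto
  next
    case False
    define x y where "x = \<bar>a\<bar> / (1 - t)" and "y = \<bar>b\<bar> / t"
    have xy: "x > 0" "y > 0" using False t by (auto simp: x_def y_def)
    have "\<bar>a + b\<bar> powr p \<le> ((1 - t) * x + t * y) powr p"
      using t p by (intro powr_mono2) (auto simp: x_def y_def)
    also have "\<dots> \<le> (1 - t) * x powr p + t * y powr p"
      using convex_onD[OF powr_convex[OF p], of t x y] xy t by auto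
    also have "\<dots> = (1 - t) powr (1 - p) * \<bar>a\<bar> powr p + t powr (1 - p) * \<bar>b\<bar> powr p"
      using t by (simp add: x_def y_def powr_divide powr_diff)
    finally show ?thesis .
  qed
qed

text \<open>
  The pointwise form of the Brezis--Lieb lemma: a perturbation \<open>b\<close> changes \<open>|a|\<^sup>p\<close> by an arbitrarily
  small fraction of itself plus a multiple of \<open>|b|\<^sup>p\<close>.
\<close>
lemma abs_powr_diff_le:
  fixes p e :: real
  assumes p: "1 \<le> p" and e: "0 < e"
  obtains c where "c \<ge> 0"
    "\<And>a b. \<bar>\<bar>a\<bar> powr p - \<bar>a - b\<bar> powr p\<bar> \<le> e * (\<bar>a\<bar> powr p + \<bar>a - b\<bar> powr p) + c * \<bar>b\<bar> powr p"
proof -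
  have "((\<lambda>t::real. (1 - t) powr (1 - p)) \<longlongrightarrow> (1 - 0) powr (1 - p)) (at_right 0)"
    by (intro tendsto_intros) auto
  then have "eventually (\<lambda>t. (1 - t) powr (1 - p) < 1 + e) (at_right (0::real))"
    using e by (intro order_tendstoD(2)) auto
  moreover have "eventually (\<lambda>t::real. 0 < t \<and> t < 1) (at_right 0)"
    by (auto simp: eventually_at_right_field intro: exI[of _ 1])
  ultimately have "eventually (\<lambda>t. (1 - t) powr (1 - p) < 1 + e \<and> 0 < t \<and> t < 1) (at_right (0::real))"
    by eventually_elim auto
  then obtain t :: real where t: "(1 - t) powr (1 - p) < 1 + e" "0 < t" "t < 1"
    using eventually_happens by fastforce
  define c where "c = t powr (1 - p)"
  have main: "\<bar>a + b\<bar> powr p \<le> (1 + e) * \<bar>a\<bar> powr p + c * \<bar>b\<bar> powr p" for a b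
    using abs_add_powr_le[OF p t(2,3), of a b] mult_right_mono[OF less_imp_le[OF t(1)], of "\<bar>a\<bar> powr p"]
    by (simp add: c_def)
  have "\<bar>\<bar>a\<bar> powr p - \<bar>a - b\<bar> powr p\<bar> \<le> e * (\<bar>a\<bar> powr p + \<bar>a - b\<bar> powr p) + c * \<bar>b\<bar> powr p" for a b
  proof -
    have "0 \<le> e * \<bar>a\<bar> powr p" "0 \<le> e * \<bar>a - b\<bar> powr p" using e by auto
    then show ?thesis
      using main[of "a - b" b] main[of a "-b"] by (simp add: algebra_simps abs_le_iff)
  qed
  moreover have "c \<ge> 0" by (simp add: c_def)
  ultimately show thesis using that by blast
qed

lemma power_sum_bounded:
  assumes "\<And>F. finite F \<Longrightarrow> F \<subseteq> A \<Longrightarrow> (\<Sum>i\<in>F. \<bar>f i\<bar> powr p) \<le> M"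
  shows "power_summable p A f" "power_sum p A f \<le> M"
proof -
  show s: "power_summable p A f"
    using assms by (intro nonneg_bdd_above_summable_on) (auto simp: bdd_above_def)
  show "power_sum p A f \<le> M"
    using assms by (intro infsum_le_finite_sums[OF s]) auto
qed

lemma finite_sum_le_power_sum:
  assumes "power_summable p A f" "finite F" "F \<subseteq> A"
  shows "(\<Sum>i\<in>F. \<bar>f i\<bar> powr p) \<le> power_sum p A f"
  using assms by (intro finite_sum_le_infsum) auto

lemma power_sum_nonneg: "0 \<le> power_sum p A f"
  by (intro infsum_nonneg) auto

lemma power_sum_dominated:
  assumes "power_summable p A g" "\<And>i. i \<in> A \<Longrightarrow> \<bar>f i\<bar> \<le> \<bar>g i\<bar>" "0 \<le> p"
  shows "power_summable p A f" "power_sum p A f \<le> power_sum p A g"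
proof -
  have bd: "(\<Sum>i\<in>F. \<bar>f i\<bar> powr p) \<le> power_sum p A g" if "finite F" "F \<subseteq> A" for F
  proof -
    have "(\<Sum>i\<in>F. \<bar>f i\<bar> powr p) \<le> (\<Sum>i\<in>F. \<bar>g i\<bar> powr p)"
      using assms that by (intro sum_mono powr_mono2) auto
    then show ?thesis
      using finite_sum_le_power_sum[OF assms(1) that] by linarith
  qed
  show "power_summable p A f" using bd by (rule power_sum_bounded(1))
  show "power_sum p A f \<le> power_sum p A g" using bd by (rule power_sum_bounded(2))
qed

lemma power_sum_diff_le:
  assumes p: "1 \<le> p" and f: "power_summable p A f" and g: "power_summable p A g"
  shows "power_summable p A (\<lambda>i. f i - g i)"
    "power_sum p A (\<lambda>i. f i - g i) \<le> (1/2) powr (1 - p) * (power_sum p A f + power_sum p A g)"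
proof -
  let ?K = "(1/2::real) powr (1 - p)"
  have bd: "(\<Sum>i\<in>F. \<bar>f i - g i\<bar> powr p) \<le> ?K * (power_sum p A f + power_sum p A g)"
    if F: "finite F" "F \<subseteq> A" for F
  proof -
    have "(\<Sum>i\<in>F. \<bar>f i - g i\<bar> powr p) \<le> (\<Sum>i\<in>F. ?K * (\<bar>f i\<bar> powr p + \<bar>g i\<bar> powr p))"
    proof (rule sum_mono)
      fix i show "\<bar>f i - g i\<bar> powr p \<le> ?K * (\<bar>f i\<bar> powr p + \<bar>g i\<bar> powr p)"
        using abs_add_powr_le[OF p, of "1/2" "f i" "- g i"] by (simp add: algebra_simps)
    qed
    also have "\<dots> = ?K * ((\<Sum>i\<in>F. \<bar>f i\<bar> powr p) + (\<Sum>i\<in>F. \<bar>g i\<bar> powr p))"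
      by (simp only: sum_distrib_left[symmetric] sum.distrib)
    also have "\<dots> \<le> ?K * (power_sum p A f + power_sum p A g)"
      using finite_sum_le_power_sum[OF f F] finite_sum_le_power_sum[OF g F]
      by (intro mult_left_mono add_mono) auto
    finally show ?thesis .
  qed
  show "power_summable p A (\<lambda>i. f i - g i)" using bd by (rule power_sum_bounded(1))
  show "power_sum p A (\<lambda>i. f i - g i) \<le> ?K * (power_sum p A f + power_sum p A g)"
    using bd by (rule power_sum_bounded(2))
qed

lemma power_sum_Chebyshev:
  assumes f: "power_summable q A f" and c: "0 < c" and q: "0 \<le> q"
  shows "finite {i \<in> A. c \<le> \<bar>f i\<bar>}"
    "real (card {i \<in> A. c \<le> \<bar>f i\<bar>}) \<le> power_sum q A f / c powr q"
proof -
  let ?L = "{i \<in> A. c \<le> \<bar>f i\<bar>}"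
  have bd: "real (card F) \<le> power_sum q A f / c powr q" if F: "F \<subseteq> ?L" "finite F" for F
  proof -
    have "real (card F) * c powr q = (\<Sum>i\<in>F. c powr q)" by simp
    also have "\<dots> \<le> (\<Sum>i\<in>F. \<bar>f i\<bar> powr q)"
      using F c q by (intro sum_mono powr_mono2) auto
    also have "\<dots> \<le> power_sum q A f"
      using F by (intro finite_sum_le_power_sum[OF f]) auto
    finally show ?thesis using c by (simp add: pos_le_divide_eq)
  qed
  then have "card F \<le> nat \<lfloor>power_sum q A f / c powr q\<rfloor>" if "F \<subseteq> ?L" "finite F" for F
    using that le_nat_floor by blast
  then show fin: "finite ?L"
    using finite_if_finite_subsets_card_bdd by blast
  show "real (card ?L) \<le> power_sum q A f / c powr q"
    by (rule bd[OF order_refl fin])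
qed

lemma power_sum_Fatou:
  assumes p: "0 < p"
    and lim: "\<And>i. i \<in> A \<Longrightarrow> (\<lambda>n. f n i) \<longlonglongrightarrow> g i"
    and f: "\<And>n. power_summable p A (f n)" "\<And>n. power_sum p A (f n) \<le> M"
  shows "power_summable p A g" "power_sum p A g \<le> M"
proof -
  have bd: "(\<Sum>i\<in>F. \<bar>g i\<bar> powr p) \<le> M" if F: "finite F" "F \<subseteq> A" for F
  proof (rule LIMSEQ_le_const2)
    show "(\<lambda>n. \<Sum>i\<in>F. \<bar>f n i\<bar> powr p) \<longlonglongrightarrow> (\<Sum>i\<in>F. \<bar>g i\<bar> powr p)"
      using lim F p by (intro tendsto_sum tendsto_powr' tendsto_rabs tendsto_const) auto
    show "\<exists>N. \<forall>n\<ge>N. (\<Sum>i\<in>F. \<bar>f n i\<bar> powr p) \<le> M"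
      using finite_sum_le_power_sum[OF f(1) F] f(2) order_trans by blast
  qed
  show "power_summable p A g" using bd by (rule power_sum_bounded(1))
  show "power_sum p A g \<le> M" using bd by (rule power_sum_bounded(2))
qed

lemma power_summable_tail:
  assumes s: "power_summable p A f" and e: "0 < e"
  obtains F where "finite F" "F \<subseteq> A" "power_sum p (A - F) f < e"
proof -
  obtain F where F: "finite F" "F \<subseteq> A" "dist (\<Sum>i\<in>F. \<bar>f i\<bar> powr p) (power_sum p A f) \<le> e / 2"
    using infsum_finite_approximation[OF s, of "e/2"] e by auto
  have "power_sum p A f = power_sum p (A - F) f + power_sum p F f"
  proof -
    have "power_sum p ((A - F) \<union> F) f = power_sum p (A - F) f + power_sum p F f"
      by (rule infsum_Un_disjoint)
        (use F s in \<open>auto intro: summable_on_subset_banach[OF s] simp del: infsum_finite\<close>)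
    moreover have "(A - F) \<union> F = A" using F by auto
    ultimately show ?thesis by simp
  qed
  then have "power_sum p (A - F) f \<le> e / 2" using F by (simp add: dist_real_def)
  then show thesis using that[of F] F e by auto
qed

text \<open>
  Outside a large finite set the limit \<open>g\<close> carries almost no mass, and there \<open>abs_powr_diff_le\<close>
  makes the \<open>p\<close>-sums of \<open>f\<^sub>n\<close> and \<open>f\<^sub>n - g\<close> nearly equal; on the finite set \<open>f\<^sub>n - g\<close> tends to 0.
\<close>
lemma Brezis_Lieb:
  assumes p: "1 \<le> p"
    and lim: "\<And>i. i \<in> A \<Longrightarrow> (\<lambda>n. f n i) \<longlonglongrightarrow> g i"
    and f: "\<And>n. power_summable p A (f n)" "\<And>n. power_sum p A (f n) \<le> M"
  shows "(\<lambda>n. power_sum p A (f n) - power_sum p A (\<lambda>i. f n i - g i)) \<longlonglongrightarrow> power_sum p A g"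
proof (rule LIMSEQ_I)
  fix e :: real assume e: "0 < e"
  have g: "power_summable p A g" "power_sum p A g \<le> M"
    using power_sum_Fatou[OF _ lim f] p by auto
  define K where "K = M + (1/2::real) powr (1 - p) * (M + M) + 1"
  have M0: "0 \<le> M" using power_sum_nonneg[where f = g and p = p and A = A] g(2) by linarith
  have K: "K > 0" using M0 by (auto simp: K_def intro!: add_nonneg_pos)
  have fg: "power_summable p A (\<lambda>i. f n i - g i)" for n
    by (rule power_sum_diff_le(1)[OF p f(1) g(1)])
  have Kn: "power_sum p A (f n) + power_sum p A (\<lambda>i. f n i - g i) \<le> K" for n
  proof -
    have "(1/2::real) powr (1 - p) * (power_sum p A (f n) + power_sum p A g)
        \<le> (1/2::real) powr (1 - p) * (M + M)"
      using f(2)[of n] g(2) by (intro mult_left_mono add_mono) auto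
    then show ?thesis
      using power_sum_diff_le(2)[OF p f(1)[of n] g(1)] f(2)[of n] unfolding K_def by linarith
  qed
  obtain c where c: "c \<ge> 0"
    "\<And>a b. \<bar>\<bar>a\<bar> powr p - \<bar>a - b\<bar> powr p\<bar>
       \<le> (e / (3 * K)) * (\<bar>a\<bar> powr p + \<bar>a - b\<bar> powr p) + c * \<bar>b\<bar> powr p"
    using abs_powr_diff_le[OF p, of "e / (3 * K)"] e K by auto
  obtain F where F: "finite F" "F \<subseteq> A" "power_sum p (A - F) g < e / (3 * (c + 1))"
    using power_summable_tail[OF g(1), of "e / (3 * (c + 1))"] e c by auto
  define h where "h n i = \<bar>f n i\<bar> powr p - \<bar>f n i - g i\<bar> powr p - \<bar>g i\<bar> powr p" for n i
  have sub: "power_summable p B (f n)" "power_summable p B (\<lambda>i. f n i - g i)" "power_summable p B g"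
    if "B \<subseteq> A" for B n
    using that f(1) fg g(1) summable_on_subset_banach by blast+
  have hs: "h n summable_on B"
    and hsum: "infsum (h n) B = power_sum p B (f n) - power_sum p B (\<lambda>i. f n i - g i) - power_sum p B g"
    if "B \<subseteq> A" for B n
  proof -
    have "((\<lambda>i. (\<bar>f n i\<bar> powr p + - (\<bar>f n i - g i\<bar> powr p)) + - (\<bar>g i\<bar> powr p)) has_sum
       (power_sum p B (f n) + - power_sum p B (\<lambda>i. f n i - g i)) + - power_sum p B g) B"
      using sub[OF that] by (intro has_sum_add has_sum_uminusI has_sum_infsum)
    then have "(h n has_sum (power_sum p B (f n) - power_sum p B (\<lambda>i. f n i - g i)) - power_sum p B g) B"
      by (simp add: h_def[abs_def])
    then show "h n summable_on B"
      "infsum (h n) B = power_sum p B (f n) - power_sum p B (\<lambda>i. f n i - g i) - power_sum p B g"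
      by (auto simp: summable_on_def infsumI)
  qed
  \<comment> \<open>On the tail the three sums differ by an arbitrarily small part of the bounded quantity \<open>K\<close>,
    plus a multiple of the small tail of \<open>g\<close>.\<close>
  have tail: "\<bar>infsum (h n) (A - F)\<bar> < 2 * e / 3" for n
  proof -
    let ?B = "A - F"
    let ?b = "\<lambda>i. (e / (3 * K)) * (\<bar>f n i\<bar> powr p + \<bar>f n i - g i\<bar> powr p) + (c + 1) * \<bar>g i\<bar> powr p"
    have bs: "(?b has_sum (e / (3 * K)) * (power_sum p ?B (f n) + power_sum p ?B (\<lambda>i. f n i - g i))
        + (c + 1) * power_sum p ?B g) ?B"
      using sub[of ?B] by (intro has_sum_add has_sum_cmult_right has_sum_infsum) auto
    have hb: "\<bar>h n i\<bar> \<le> ?b i" for i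
      using c(2)[of "f n i" "g i"] powr_ge_zero[of "\<bar>g i\<bar>" p]
      unfolding h_def distrib_right[of c] by linarith
    have b: "?b summable_on ?B" using bs by (rule has_sum_imp_summable)
    have "infsum (h n) ?B \<le> infsum ?b ?B"
      using hs[of ?B n] b hb by (intro infsum_mono) (auto simp only: abs_le_iff)
    moreover have "- infsum (h n) ?B \<le> infsum ?b ?B"
    proof -
      have "(\<lambda>i. - h n i) summable_on ?B"
        using hs[of ?B n] by (simp add: summable_on_uminus)
      then have "infsum (\<lambda>i. - h n i) ?B \<le> infsum ?b ?B"
        using b hb by (intro infsum_mono) (auto simp only: abs_le_iff)
      then show ?thesis by (simp only: infsum_uminus)
    qed
    ultimately have "\<bar>infsum (h n) ?B\<bar> \<le>
        (e / (3 * K)) * (power_sum p ?B (f n) + power_sum p ?B (\<lambda>i. f n i - g i)) + (c + 1) * power_sum p ?B g"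
      using infsumI[OF bs] by linarith
    also have "\<dots> < (e / (3 * K)) * K + (c + 1) * (e / (3 * (c + 1)))"
    proof (intro add_le_less_mono mult_left_mono mult_strict_left_mono F(3))
      have "power_sum p ?B (f n) \<le> power_sum p A (f n)"
        "power_sum p ?B (\<lambda>i. f n i - g i) \<le> power_sum p A (\<lambda>i. f n i - g i)"
        using sub[of ?B] f(1) fg by (auto intro!: infsum_mono2)
      then show "power_sum p ?B (f n) + power_sum p ?B (\<lambda>i. f n i - g i) \<le> K"
        using Kn[of n] by linarith
    qed (use e K c in auto)
    also have "\<dots> = 2 * e / 3" using K c by (simp add: field_simps)
    finally show ?thesis .
  qed
  \<comment> \<open>On the finite set, \<open>h\<close> vanishes in the limit pointwise.\<close>
  have "(\<lambda>n. \<Sum>i\<in>F. h n i) \<longlonglongrightarrow> (\<Sum>i\<in>F. \<bar>g i\<bar> powr p - \<bar>g i - g i\<bar> powr p - \<bar>g i\<bar> powr p)"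
    unfolding h_def using lim F p
    by (intro tendsto_sum tendsto_diff tendsto_powr' tendsto_rabs tendsto_const) auto
  then have "(\<lambda>n. \<Sum>i\<in>F. h n i) \<longlonglongrightarrow> 0" by simp
  then obtain N where N: "\<And>n. n \<ge> N \<Longrightarrow> \<bar>\<Sum>i\<in>F. h n i\<bar> < e / 3"
    using LIMSEQ_D[of _ 0 "e/3"] e by (metis diff_zero divide_pos_pos real_norm_def zero_less_numeral)
  have "norm (power_sum p A (f n) - power_sum p A (\<lambda>i. f n i - g i) - power_sum p A g) < e"
    if n: "n \<ge> N" for n
  proof -
    have "infsum (h n) (F \<union> (A - F)) = infsum (h n) F + infsum (h n) (A - F)"
      using hs F by (intro infsum_Un_disjoint) auto
    moreover have "F \<union> (A - F) = A" using F by auto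
    ultimately have "infsum (h n) A = (\<Sum>i\<in>F. h n i) + infsum (h n) (A - F)" using F by simp
    then show ?thesis
      using hsum[of A n] tail[of n] N[OF n] by auto
  qed
  then show "\<exists>N. \<forall>n\<ge>N. norm (power_sum p A (f n) - power_sum p A (\<lambda>i. f n i - g i) - power_sum p A g) < e"
    by blast
qed

section \<open>Energy on Cayley graphs\<close>

text \<open>
  Every edge is listed in both directions, as in the double sum over \<open>x\<close> and \<open>y \<sim> x\<close>. The energy is
  then a \<open>p\<close>-sum over one index set, and the results on \<open>p\<close>-sums apply to gradients.
\<close>
definition edges :: "('a, 'b) monoid_scheme \<Rightarrow> 'a set \<Rightarrow> ('a \<times> 'a) set" where
  "edges G S = (SIGMA x : carrier G. {y. cayley_adj G S x y})"

definition grad :: "('a \<Rightarrow> real) \<Rightarrow> 'a \<times> 'a \<Rightarrow> real" where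
  "grad u = (\<lambda>(x, y). u y - u x)"

abbreviation energy :: "('a, 'b) monoid_scheme \<Rightarrow> 'a set \<Rightarrow> real \<Rightarrow> ('a \<Rightarrow> real) \<Rightarrow> real" where
  "energy G S p u \<equiv> power_sum p (edges G S) (grad u)"

lemma grad_diff: "grad (\<lambda>x. u x - v x) = (\<lambda>e. grad u e - grad v e)"
  by (auto simp: grad_def fun_eq_iff)

locale cayley_graph = group G for G (structure) +
  fixes S :: "'a set"
  assumes finite_gens: "finite S" and gens_closed: "S \<subseteq> carrier G"
    and generates: "generate G S = carrier G"
begin

lemma sym_gens_closed: "sym_gens G S \<subseteq> carrier G"
  using gens_closed by (auto simp: sym_gens_def)

lemma finite_neighbours: "finite {y. cayley_adj G S x y}"
proof (rule finite_subset)
  show "{y. cayley_adj G S x y} \<subseteq> (\<lambda>s. x \<otimes> s) ` sym_gens G S"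
    by (auto simp: cayley_adj_def)
  show "finite ((\<lambda>s. x \<otimes> s) ` sym_gens G S)"
    using finite_gens by (simp add: sym_gens_def)
qed

lemma finite_energy_iff: "finite_energy G S p u \<longleftrightarrow> power_summable p (edges G S) (grad u)"
proof -
  let ?f = "\<lambda>e. \<bar>grad u e\<bar> powr p"
  have "(\<lambda>e. norm (?f e)) summable_on edges G S \<longleftrightarrow>
      (\<lambda>x. norm (local_energy G S p u x)) summable_on carrier G"
    using Infinite_Sum.abs_summable_on_Sigma_iff[where f = ?f and A = "carrier G" and B = "\<lambda>x. {y. cayley_adj G S x y}"] finite_neighbours
    by (simp add: edges_def local_energy_def grad_def)
  moreover have "norm (local_energy G S p u x) = local_energy G S p u x" for x
    by (simp add: local_energy_def sum_nonneg)
  ultimately show ?thesis by (simp add: finite_energy_def)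
qed

lemma D1p_norm_eq:
  assumes "power_summable p (edges G S) (grad u)"
  shows "D1p_norm G S p u = energy G S p u powr (1 / p)"
proof -
  have "energy G S p u = (\<Sum>\<^sub>\<infinity>x\<in>carrier G. \<Sum>\<^sub>\<infinity>y\<in>{y. cayley_adj G S x y}. \<bar>grad u (x, y)\<bar> powr p)"
    using assms unfolding edges_def by (rule infsum_Sigma_banach[symmetric])
  also have "\<dots> = (\<Sum>\<^sub>\<infinity>x\<in>carrier G. local_energy G S p u x)"
    using finite_neighbours by (intro infsum_cong) (simp add: local_energy_def grad_def)
  finally show ?thesis by (simp add: D1p_norm_def)
qed

lemma translation_bij:
  assumes g: "g \<in> carrier G"
  shows "bij_betw (\<lambda>x. g \<otimes> x) (carrier G) (carrier G)"
proof (rule bij_betw_byWitness[where f' = "\<lambda>x. inv g \<otimes> x"])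
qed (use g in \<open>auto simp: m_assoc[symmetric]\<close>)

text \<open>
  Edges are given by right multiplication with generators, so left translations are automorphisms of
  the graph; this is why minimizing sequences may be recentred.
\<close>
lemma translation_bij_edges:
  assumes g: "g \<in> carrier G"
  shows "bij_betw (\<lambda>(x, y). (g \<otimes> x, g \<otimes> y)) (edges G S) (edges G S)"
proof -
  have adj: "cayley_adj G S (h \<otimes> x) (h \<otimes> y)" if h: "h \<in> carrier G" and "cayley_adj G S x y" for h x y
    using that sym_gens_closed unfolding cayley_adj_def by (auto simp: m_assoc subset_iff)
  have "x \<in> carrier G" "y \<in> carrier G" if "cayley_adj G S x y" for x y
    using that by (auto simp: cayley_adj_def)
  then show ?thesis
    using g adj[OF g] adj[OF inv_closed[OF g]]
    by (intro bij_betw_byWitness[where f' = "\<lambda>(x, y). (inv g \<otimes> x, inv g \<otimes> y)"])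
      (auto simp: edges_def m_assoc[symmetric])
qed

lemma translate_power_sum:
  assumes g: "g \<in> carrier G"
  shows "power_summable q (carrier G) (\<lambda>x. u (g \<otimes> x)) \<longleftrightarrow> power_summable q (carrier G) u"
    "power_sum q (carrier G) (\<lambda>x. u (g \<otimes> x)) = power_sum q (carrier G) u"
  using summable_on_reindex_bij_betw[OF translation_bij[OF g], of "\<lambda>x. \<bar>u x\<bar> powr q"]
    infsum_reindex_bij_betw[OF translation_bij[OF g], of "\<lambda>x. \<bar>u x\<bar> powr q"] by simp_all

lemma translate_energy:
  assumes g: "g \<in> carrier G"
  shows "power_summable p (edges G S) (grad (\<lambda>x. u (g \<otimes> x))) \<longleftrightarrow> power_summable p (edges G S) (grad u)"
    "energy G S p (\<lambda>x. u (g \<otimes> x)) = energy G S p u"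
  using summable_on_reindex_bij_betw[OF translation_bij_edges[OF g], of "\<lambda>e. \<bar>grad u e\<bar> powr p"]
    infsum_reindex_bij_betw[OF translation_bij_edges[OF g], of "\<lambda>e. \<bar>grad u e\<bar> powr p"]
  by (simp_all add: grad_def case_prod_unfold)

lemma word_closed: "set ws \<subseteq> sym_gens G S \<Longrightarrow> foldr (\<otimes>) ws \<one> \<in> carrier G"
  using sym_gens_closed by (induction ws) auto

lemma exists_word:
  assumes "g \<in> carrier G"
  shows "\<exists>ws. set ws \<subseteq> sym_gens G S \<and> g = foldr (\<otimes>) ws \<one>"
proof -
  have "g \<in> generate G S" using assms generates by simp
  then show ?thesis
  proof (induction rule: generate.induct)
    case one
    show ?case by (intro exI[of _ "[]"]) simp
  next
    case (incl h)
    then show ?case using gens_closed by (intro exI[of _ "[h]"]) (auto simp: sym_gens_def)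
  next
    case (inv h)
    then show ?case using gens_closed by (intro exI[of _ "[inv h]"]) (auto simp: sym_gens_def)
  next
    case (eng h1 h2)
    then obtain v w where vw: "set v \<subseteq> sym_gens G S" "h1 = foldr (\<otimes>) v \<one>"
      "set w \<subseteq> sym_gens G S" "h2 = foldr (\<otimes>) w \<one>" by blast
    have "foldr (\<otimes>) (v @ w) \<one> = foldr (\<otimes>) v \<one> \<otimes> foldr (\<otimes>) w \<one>"
      using vw(1) 
    proof (induction v)
      case Nil
      show ?case using word_closed[OF vw(3)] by simp
    next
      case (Cons s v)
      then show ?case
        using word_closed[OF vw(3)] word_closed[of v] sym_gens_closed by (auto simp: m_assoc)
    qed
    then show ?case using vw by (intro exI[of _ "v @ w"]) auto
  qed
qed

lemma shortest_word:
  assumes "g \<in> carrier G"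
  obtains ws where "length ws = word_length G S g" "set ws \<subseteq> sym_gens G S" "g = foldr (\<otimes>) ws \<one>"
proof -
  have "\<exists>n ws. length ws = n \<and> set ws \<subseteq> sym_gens G S \<and> g = foldr (\<otimes>) ws \<one>"
    using exists_word[OF assms] by blast
  from LeastI_ex[OF this] show thesis
    using that unfolding word_length_def by blast
qed

text \<open>
  Right multiplication by a generator moves along edges, and a given directed edge is used at most
  once as \<open>x\<close> varies.
\<close>
lemma sum_generator_displacement_le:
  assumes E: "power_summable p (edges G S) (grad u)" and p: "0 < p"
    and s: "s \<in> sym_gens G S" and F: "finite F" "F \<subseteq> carrier G"
  shows "(\<Sum>x\<in>F. \<bar>u (x \<otimes> s) - u x\<bar> powr p) \<le> energy G S p u"
proof -
  let ?F = "{x \<in> F. x \<otimes> s \<noteq> x}"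
  have inj: "inj_on (\<lambda>x. (x, x \<otimes> s)) ?F" by (auto simp: inj_on_def)
  have "(\<Sum>x\<in>F. \<bar>u (x \<otimes> s) - u x\<bar> powr p) = (\<Sum>x\<in>?F. \<bar>u (x \<otimes> s) - u x\<bar> powr p)"
    using F p by (intro sum.mono_neutral_right) auto
  also have "\<dots> = (\<Sum>e\<in>(\<lambda>x. (x, x \<otimes> s)) ` ?F. \<bar>grad u e\<bar> powr p)"
    unfolding sum.reindex[OF inj] by (simp add: grad_def)
  also have "\<dots> \<le> energy G S p u"
    using F s sym_gens_closed
    by (intro finite_sum_le_power_sum[OF E]) (auto simp: edges_def cayley_adj_def)
  finally show ?thesis .
qed

text \<open>
  This is the \<open>\<ell>\<^sup>p\<close> triangle inequality along the path spelled out by a word, stated for finite partial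
  sums so that no summability of the displaced function has to be known in advance.
\<close>
lemma sum_word_displacement_le:
  assumes E: "power_summable p (edges G S) (grad u)" and p: "1 \<le> p"
    and "set ws \<subseteq> sym_gens G S" "finite F" "F \<subseteq> carrier G"
  shows "(\<Sum>x\<in>F. \<bar>u (x \<otimes> foldr (\<otimes>) ws \<one>) - u x\<bar> powr p)
    \<le> real (length ws) powr p * energy G S p u"
  using assms(3-)
proof (induction ws arbitrary: F)
  case Nil
  have "(\<Sum>x\<in>F. \<bar>u (x \<otimes> \<one>) - u x\<bar> powr p) = 0"
    using Nil p by (intro sum.neutral) (auto simp: subset_iff)
  then show ?case using p by simp
next
  case (Cons s ws)
  define w where "w = foldr (\<otimes>) ws \<one>"
  have s: "s \<in> sym_gens G S" "s \<in> carrier G" and w: "w \<in> carrier G"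
    using Cons.prems sym_gens_closed word_closed by (auto simp: w_def)
  have step: "(\<Sum>x\<in>F. \<bar>u (x \<otimes> s) - u x\<bar> powr p) \<le> energy G S p u"
    using sum_generator_displacement_le[OF E _ s(1)] Cons.prems p by auto
  show ?case
  proof (cases "ws = []")
    case True
    then show ?thesis using step s by simp
  next
    case False
    define k where "k = real (length ws)"
    have k: "k > 0" using False by (simp add: k_def)
    \<comment> \<open>With this weight the constants add up exactly:
      \<open>(1 - t)\<^sup>1\<^sup>-\<^sup>p k\<^sup>p + t\<^sup>1\<^sup>-\<^sup>p = (k + 1)\<^sup>p\<close>.\<close>
    define t where "t = 1 / (k + 1)"
    have t: "0 < t" "t < 1" "1 - t = k / (k + 1)" using k by (auto simp: t_def field_simps)
    let ?E = "energy G S p u"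
    have inj: "inj_on (\<lambda>x. x \<otimes> s) F" using Cons.prems s by (auto simp: inj_on_def subset_iff)
    have "(\<Sum>x\<in>F. \<bar>u ((x \<otimes> s) \<otimes> w) - u (x \<otimes> s)\<bar> powr p)
        = (\<Sum>x\<in>(\<lambda>x. x \<otimes> s) ` F. \<bar>u (x \<otimes> w) - u x\<bar> powr p)"
      unfolding sum.reindex[OF inj] by simp
    also have "\<dots> \<le> k powr p * ?E"
      using Cons.IH[of "(\<lambda>x. x \<otimes> s) ` F"] Cons.prems s by (auto simp: k_def w_def)
    finally have rest: "(\<Sum>x\<in>F. \<bar>u ((x \<otimes> s) \<otimes> w) - u (x \<otimes> s)\<bar> powr p) \<le> k powr p * ?E" .
    have "(\<Sum>x\<in>F. \<bar>u (x \<otimes> foldr (\<otimes>) (s # ws) \<one>) - u x\<bar> powr p)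
        \<le> (\<Sum>x\<in>F. (1 - t) powr (1 - p) * \<bar>u ((x \<otimes> s) \<otimes> w) - u (x \<otimes> s)\<bar> powr p
             + t powr (1 - p) * \<bar>u (x \<otimes> s) - u x\<bar> powr p)"
    proof (rule sum_mono)
      fix x assume "x \<in> F"
      then have "x \<otimes> foldr (\<otimes>) (s # ws) \<one> = (x \<otimes> s) \<otimes> w"
        using Cons.prems s w by (auto simp: w_def m_assoc)
      then show "\<bar>u (x \<otimes> foldr (\<otimes>) (s # ws) \<one>) - u x\<bar> powr p
          \<le> (1 - t) powr (1 - p) * \<bar>u ((x \<otimes> s) \<otimes> w) - u (x \<otimes> s)\<bar> powr p
             + t powr (1 - p) * \<bar>u (x \<otimes> s) - u x\<bar> powr p"
        using abs_add_powr_le[OF p t(1,2), of "u ((x \<otimes> s) \<otimes> w) - u (x \<otimes> s)" "u (x \<otimes> s) - u x"]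
        by simp
    qed
    also have "\<dots> \<le> (1 - t) powr (1 - p) * (k powr p * ?E) + t powr (1 - p) * ?E"
      unfolding sum.distrib sum_distrib_left[symmetric]
      using rest step by (intro add_mono mult_left_mono) auto
    also have "\<dots> = (k + 1) powr p * ?E"
    proof -
      have "(k + 1) powr (1 - p) = 1 / (k + 1) powr (p - 1)"
        using powr_minus_divide[of "k + 1" "p - 1"] by simp
      moreover have "k powr (1 - p) * k powr p = k"
        using k by (simp flip: powr_add)
      moreover have "(k + 1) * (k + 1) powr (p - 1) = (k + 1) powr p"
        using k by (simp add: powr_mult_base)
      ultimately have "(1 - t) powr (1 - p) * k powr p = k * (k + 1) powr (p - 1)"
        and "t powr (1 - p) = (k + 1) powr (p - 1)" and pw: "(k + 1) powr p = (k + 1) * (k + 1) powr (p - 1)"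
        unfolding t(3) using k by (auto simp: t_def powr_divide mult.commute mult.left_commute)
      then have "(1 - t) powr (1 - p) * (k powr p * ?E) + t powr (1 - p) * ?E
          = k * (k + 1) powr (p - 1) * ?E + (k + 1) powr (p - 1) * ?E"
        by (simp only: mult.assoc[symmetric])
      also have "\<dots> = (k + 1) powr p * ?E" unfolding pw by (simp only: distrib_right mult_1)
      finally show ?thesis .
    qed
    finally show ?thesis by (simp add: k_def add.commute)
  qed
qed

lemma sum_displacement_le:
  assumes E: "power_summable p (edges G S) (grad u)" and p: "1 \<le> p"
    and h: "h \<in> carrier G" "word_length G S h \<le> r" and F: "finite F" "F \<subseteq> carrier G"
  shows "(\<Sum>x\<in>F. \<bar>u (x \<otimes> h) - u x\<bar> powr p) \<le> real r powr p * energy G S p u"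
proof -
  obtain ws where ws: "length ws = word_length G S h" "set ws \<subseteq> sym_gens G S" "h = foldr (\<otimes>) ws \<one>"
    using shortest_word[OF h(1)] .
  have "(\<Sum>x\<in>F. \<bar>u (x \<otimes> h) - u x\<bar> powr p) \<le> real (length ws) powr p * energy G S p u"
    using sum_word_displacement_le[OF E p ws(2) F] ws(3) by simp
  also have "\<dots> \<le> real r powr p * energy G S p u"
    using h ws(1) p by (intro mult_right_mono powr_mono2 power_sum_nonneg) auto
  finally show ?thesis .
qed

end

section \<open>Approximation by finitely supported functions\<close>

text \<open>
  The map \<open>t \<mapsto> sgn t max(|t| - e, 0)\<close>, for \<open>e \<ge> 0\<close>, written so that linear arithmetic handles it.
\<close>
definition soft_threshold :: "real \<Rightarrow> real \<Rightarrow> real" where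
  "soft_threshold e t = t - max (- e) (min e t)"

lemma soft_threshold_contraction:
  "0 \<le> e \<Longrightarrow> \<bar>soft_threshold e s - soft_threshold e t\<bar> \<le> \<bar>s - t\<bar>"
  by (auto simp: soft_threshold_def max_def min_def)

lemma soft_threshold_dist: "0 \<le> e \<Longrightarrow> \<bar>soft_threshold e t - t\<bar> \<le> e"
  by (auto simp: soft_threshold_def max_def min_def)

lemma soft_threshold_nonzero: "soft_threshold e t \<noteq> 0 \<Longrightarrow> e \<le> \<bar>t\<bar>"
  by (auto simp: soft_threshold_def max_def min_def split: if_splits)

context cayley_graph
begin

lemma cayley_adj_sym:
  assumes "cayley_adj G S x y"
  shows "cayley_adj G S y x"
proof -
  obtain s where s: "s \<in> sym_gens G S" "y = x \<otimes> s" and xy: "x \<in> carrier G" "y \<in> carrier G" "x \<noteq> y"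
    using assms by (auto simp: cayley_adj_def)
  have "inv s \<in> sym_gens G S" "s \<in> carrier G"
    using s(1) gens_closed by (auto simp: sym_gens_def subset_iff)
  moreover have "x = y \<otimes> inv s" using s xy \<open>s \<in> carrier G\<close> by (simp add: m_assoc)
  ultimately show ?thesis using xy unfolding cayley_adj_def by auto
qed

lemma finitely_supported_finite_energy:
  assumes fs: "finitely_supported G u" and p: "0 < p"
  shows "power_summable p (edges G S) (grad u)"
proof -
  let ?N = "SIGMA x : {x \<in> carrier G. u x \<noteq> 0}. {y. cayley_adj G S x y}"
  have fin: "finite (?N \<union> prod.swap ` ?N)"
    using fs finite_neighbours by (simp add: finitely_supported_def)
  have "{e \<in> edges G S. \<bar>grad u e\<bar> powr p \<noteq> 0} \<subseteq> ?N \<union> prod.swap ` ?N"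
  proof
    fix e assume "e \<in> {e \<in> edges G S. \<bar>grad u e\<bar> powr p \<noteq> 0}"
    then obtain x y where e: "e = (x, y)" "cayley_adj G S x y" "u x \<noteq> 0 \<or> u y \<noteq> 0"
      using p by (cases e) (auto simp: edges_def grad_def)
    moreover have "x \<in> carrier G" "y \<in> carrier G" using e(2) by (auto simp: cayley_adj_def)
    moreover have "(x, y) \<in> prod.swap ` ?N" if "u y \<noteq> 0"
      using that e cayley_adj_sym[OF e(2)] \<open>y \<in> carrier G\<close>
      by (intro image_eqI[of _ _ "(y, x)"]) auto
    ultimately show "e \<in> ?N \<union> prod.swap ` ?N" by auto
  qed
  then have "finite {e \<in> edges G S. \<bar>grad u e\<bar> powr p \<noteq> 0}"
    using fin finite_subset by blast
  then show ?thesis by (rule finite_nonzero_values_imp_summable_on)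
qed

lemma D1p_finite_energy:
  assumes u: "u \<in> D1p G S p" and p: "1 \<le> p"
  shows "power_summable p (edges G S) (grad u)"
proof -
  obtain \<phi> where \<phi>: "finitely_supported G (\<phi> 0)" "finite_energy G S p (\<lambda>x. \<phi> (0::nat) x - u x)"
    using u by (auto simp: D1p_def)
  have "power_summable p (edges G S) (grad (\<phi> 0))"
    using finitely_supported_finite_energy[OF \<phi>(1)] p by simp
  moreover have "power_summable p (edges G S) (grad (\<lambda>x. \<phi> 0 x - u x))"
    using \<phi>(2) by (simp only: finite_energy_iff)
  ultimately have "power_summable p (edges G S) (\<lambda>e. grad (\<phi> 0) e - grad (\<lambda>x. \<phi> 0 x - u x) e)"
    by (rule power_sum_diff_le(1)[OF p])
  then show ?thesis by (simp add: grad_diff)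
qed

text \<open>
  Approximate by soft thresholding at level \<open>e \<rightarrow> 0\<close>. The approximants are finitely supported since
  \<open>|u| \<ge> e\<close> holds at only finitely many points. Thresholding is a contraction, so their energies
  do not exceed that of \<open>u\<close>; by the Brezis--Lieb lemma there is then no energy left for the difference.
  Together with \<open>D1p_finite_energy\<close> this shows that, among functions with finite \<open>q\<close>-sum, membership
  in \<open>D1p\<close> just means finite energy.
\<close>
lemma in_D1p_if_power_summable:
  assumes p: "1 \<le> p" and q: "0 \<le> q"
    and E: "power_summable p (edges G S) (grad u)" and N: "power_summable q (carrier G) u"
  shows "u \<in> D1p G S p"
proof -
  define e where "e k = 1 / real (Suc k)" for k
  have e: "0 < e k" for k by (simp add: e_def)
  have e0: "e \<longlonglongrightarrow> 0" unfolding e_def by (rule LIMSEQ_Suc[OF lim_1_over_n])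
  define \<phi> where "\<phi> k x = soft_threshold (e k) (u x)" for k x
  have lim: "(\<lambda>k. \<phi> k x) \<longlonglongrightarrow> u x" for x
  proof (rule Lim_transform)
    show "(\<lambda>k. u x) \<longlonglongrightarrow> u x" by simp
    show "(\<lambda>k. \<phi> k x - u x) \<longlonglongrightarrow> 0"
    proof (rule Lim_null_comparison[OF _ e0])
      show "eventually (\<lambda>k. norm (\<phi> k x - u x) \<le> e k) sequentially"
        using soft_threshold_dist[OF less_imp_le[OF e]] by (simp add: \<phi>_def)
    qed
  qed
  have fs: "finitely_supported G (\<phi> k)" for k
    unfolding finitely_supported_def
  proof (rule finite_subset)
    show "{x \<in> carrier G. \<phi> k x \<noteq> 0} \<subseteq> {x \<in> carrier G. e k \<le> \<bar>u x\<bar>}"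
      using soft_threshold_nonzero by (auto simp: \<phi>_def)
    show "finite {x \<in> carrier G. e k \<le> \<bar>u x\<bar>}"
      by (rule power_sum_Chebyshev(1)[OF N e q])
  qed
  have le: "\<bar>grad (\<phi> k) a\<bar> \<le> \<bar>grad u a\<bar>" for k a
    using soft_threshold_contraction[OF less_imp_le[OF e]] by (cases a) (simp add: grad_def \<phi>_def)
  have \<phi>E: "power_summable p (edges G S) (grad (\<phi> k))" "energy G S p (\<phi> k) \<le> energy G S p u" for k
    using power_sum_dominated[OF E le, of "\<lambda>_. k"] p by auto
  have dE: "power_summable p (edges G S) (grad (\<lambda>x. \<phi> k x - u x))" for k
    using power_sum_diff_le(1)[OF p \<phi>E(1) E] by (simp add: grad_diff)
  have "(\<lambda>k. grad (\<phi> k) a) \<longlonglongrightarrow> grad u a" for a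
    using lim by (cases a) (auto simp: grad_def intro!: tendsto_diff)
  from Brezis_Lieb[OF p this \<phi>E]
  have BL: "(\<lambda>k. energy G S p (\<phi> k) - energy G S p (\<lambda>x. \<phi> k x - u x)) \<longlonglongrightarrow> energy G S p u"
    by (simp add: grad_diff)
  have "(\<lambda>k. energy G S p (\<lambda>x. \<phi> k x - u x)) \<longlonglongrightarrow> 0"
  proof (rule tendsto_sandwich[where f = "\<lambda>_. 0"])
    show "(\<lambda>k. energy G S p u - (energy G S p (\<phi> k) - energy G S p (\<lambda>x. \<phi> k x - u x))) \<longlonglongrightarrow> 0"
      using tendsto_diff[OF tendsto_const BL, of "energy G S p u"] by simp
    show "eventually (\<lambda>k. energy G S p (\<lambda>x. \<phi> k x - u x)
        \<le> energy G S p u - (energy G S p (\<phi> k) - energy G S p (\<lambda>x. \<phi> k x - u x))) sequentially"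
      using \<phi>E(2) by simp
    show "eventually (\<lambda>k. 0 \<le> energy G S p (\<lambda>x. \<phi> k x - u x)) sequentially"
      by (simp add: power_sum_nonneg)
  qed simp
  then have "(\<lambda>k. energy G S p (\<lambda>x. \<phi> k x - u x) powr (1 / p)) \<longlonglongrightarrow> 0 powr (1 / p)"
    using p by (intro tendsto_powr') (auto simp: power_sum_nonneg)
  then have "(\<lambda>k. D1p_norm G S p (\<lambda>x. \<phi> k x - u x)) \<longlonglongrightarrow> 0"
    using p by (simp add: D1p_norm_eq[OF dE])
  then show ?thesis
    using lim fs dE unfolding D1p_def by (auto simp: finite_energy_iff intro!: exI[of _ \<phi>])
qed

end

section \<open>A lower bound for the supremum norm\<close>

context cayley_graph
begin

text \<open>
  If the ball of radius \<open>r\<close> has at least \<open>2 (2/|u(x)|)\<^sup>q\<close> elements, then by Chebyshev's inequality at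
  most half of them satisfy \<open>|u(xh)| \<ge> |u(x)|/2\<close>. The other half sees a jump of at least \<open>|u(x)|/2\<close>
  between \<open>x\<close> and \<open>xh\<close>, and the displacement estimate bounds the total of these jumps.
\<close>
lemma sum_powr_le_if_ball_large:
  assumes p: "1 \<le> p" and q: "0 \<le> q"
    and N: "power_summable q (carrier G) u" "power_sum q (carrier G) u = 1"
    and E: "power_summable p (edges G S) (grad u)"
    and F: "finite F" "F \<subseteq> carrier G"
    and r: "\<And>x. x \<in> F \<Longrightarrow> u x \<noteq> 0 \<and> 2 * (2 / \<bar>u x\<bar>) powr q \<le> real (growth G S r)"
  shows "(\<Sum>x\<in>F. \<bar>u x\<bar> powr p) \<le> 2 * 2 powr p * (real r powr p * energy G S p u)"
proof (cases "F = {}")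
  case True
  then show ?thesis by (simp add: power_sum_nonneg)
next
  case False
  define B where "B = {g \<in> carrier G. word_length G S g \<le> r}"
  define V where "V = real (card B)"
  have VB: "2 * (2 / \<bar>u x\<bar>) powr q \<le> V" "u x \<noteq> 0" if "x \<in> F" for x
    using r[OF that] by (auto simp: V_def B_def growth_def)
  obtain x0 where "x0 \<in> F" using False by blast
  then have V: "V > 0" using VB[of x0] by (smt (verit) powr_gt_zero divide_pos_pos zero_less_abs_iff)
  then have finB: "finite B" unfolding V_def using card_ge_0_finite by force
  have low: "V / 2 * (\<bar>u x\<bar> / 2) powr p \<le> (\<Sum>h\<in>B. \<bar>u (x \<otimes> h) - u x\<bar> powr p)" if x: "x \<in> F" for x
  proof -
    define c where "c = \<bar>u x\<bar> / 2"
    have c: "c > 0" using VB(2)[OF x] by (simp add: c_def)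
    have xG: "x \<in> carrier G" using x F by auto
    define L where "L = {h \<in> B. c \<le> \<bar>u (x \<otimes> h)\<bar>}"
    have "card L \<le> card {y \<in> carrier G. c \<le> \<bar>u y\<bar>}"
    proof (rule card_inj_on_le)
      show "inj_on (\<lambda>h. x \<otimes> h) L" using xG by (auto simp: inj_on_def L_def B_def)
      show "(\<lambda>h. x \<otimes> h) ` L \<subseteq> {y \<in> carrier G. c \<le> \<bar>u y\<bar>}" using xG by (auto simp: L_def B_def)
      show "finite {y \<in> carrier G. c \<le> \<bar>u y\<bar>}" by (rule power_sum_Chebyshev(1)[OF N(1) c q])
    qed
    then have "real (card L) \<le> real (card {y \<in> carrier G. c \<le> \<bar>u y\<bar>})" by simp
    also have "\<dots> \<le> 1 / c powr q"
      using power_sum_Chebyshev(2)[OF N(1) c q] unfolding N(2) .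
    also have "1 / c powr q = (2 / \<bar>u x\<bar>) powr q"
      by (simp add: c_def powr_divide)
    finally have L: "real (card L) \<le> V / 2" using VB(1)[OF x] by linarith
    have LB: "L \<subseteq> B" by (auto simp: L_def)
    have "V / 2 \<le> real (card (B - L))"
      using L LB finB by (simp add: card_Diff_subset finite_subset V_def of_nat_diff card_mono)
    then have "V / 2 * c powr p \<le> real (card (B - L)) * c powr p"
      by (intro mult_right_mono) auto
    also have "\<dots> = (\<Sum>h\<in>B - L. c powr p)" by simp
    also have "\<dots> \<le> (\<Sum>h\<in>B - L. \<bar>u (x \<otimes> h) - u x\<bar> powr p)"
    proof (intro sum_mono powr_mono2)
      fix h assume "h \<in> B - L"
      then have "\<bar>u (x \<otimes> h)\<bar> < c" by (auto simp: L_def)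
      then show "c \<le> \<bar>u (x \<otimes> h) - u x\<bar>" unfolding c_def by arith
    qed (use p c in auto)
    also have "\<dots> \<le> (\<Sum>h\<in>B. \<bar>u (x \<otimes> h) - u x\<bar> powr p)"
      using finB by (intro sum_mono2) auto
    finally show ?thesis by (simp add: c_def)
  qed
  have "V / 2 * (\<Sum>x\<in>F. (\<bar>u x\<bar> / 2) powr p) \<le> (\<Sum>x\<in>F. \<Sum>h\<in>B. \<bar>u (x \<otimes> h) - u x\<bar> powr p)"
    unfolding sum_distrib_left by (intro sum_mono low)
  also have "\<dots> = (\<Sum>h\<in>B. \<Sum>x\<in>F. \<bar>u (x \<otimes> h) - u x\<bar> powr p)" by (rule sum.swap)
  also have "\<dots> \<le> (\<Sum>h\<in>B. real r powr p * energy G S p u)"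
    using F by (intro sum_mono sum_displacement_le[OF E p]) (auto simp: B_def)
  also have "\<dots> = V * (real r powr p * energy G S p u)" by (simp add: V_def)
  finally have "(\<Sum>x\<in>F. (\<bar>u x\<bar> / 2) powr p) \<le> 2 * (real r powr p * energy G S p u)"
    using V by (simp add: field_simps)
  moreover have "(\<Sum>x\<in>F. \<bar>u x\<bar> powr p) = 2 powr p * (\<Sum>x\<in>F. (\<bar>u x\<bar> / 2) powr p)"
    by (simp add: sum_distrib_left powr_divide)
  ultimately show ?thesis by simp
qed

text \<open>
  A point \<open>x\<close> is assigned the smallest dyadic radius \<open>2\<^sup>k\<close> for which the growth hypothesis makes
  \<open>sum_powr_le_if_ball_large\<close> applicable. Minimality gives \<open>|u(x)|\<^sup>q \<le> A b\<close> to the power \<open>-k\<close>, where \<open>b = 2\<^sup>D\<close>. Write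
  \<open>|u|\<^sup>q = |u|\<^sup>p |u|\<^sup>\<eta> (|u|\<^sup>q)\<^sup>\<sigma>\<close> with \<open>p + \<eta> + q\<sigma> = q\<close>: the first factor is summed by \<open>sum_powr_le_if_ball_large\<close> at the cost
  of \<open>2\<close> to the power \<open>kp\<close>, the second is at most \<open>\<delta>\<^sup>\<eta>\<close>, and the third gains \<open>2\<close> to the power
  \<open>-kD\<sigma>\<close>. The gain wins if \<open>D\<sigma> > p\<close>, and the assumption on \<open>q\<close>, which is \<open>q > Dp/(D-p)\<close> cleared of the
  fraction, leaves room for this with some \<open>\<eta> > 0\<close>.
\<close>
lemma sup_norm_lower_bound:
  fixes C D :: real
  assumes C: "0 < C" and D: "0 < D"
    and growth: "\<And>r. 1 \<le> r \<Longrightarrow> C * real r powr D \<le> real (growth G S r)"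
    and p: "1 \<le> p" and q: "0 < q" "p * q < D * (q - p)"
  obtains K \<eta> where "0 \<le> K" "0 < \<eta>"
    "\<And>u \<delta>. power_summable q (carrier G) u \<Longrightarrow> power_sum q (carrier G) u = 1 \<Longrightarrow>
        power_summable p (edges G S) (grad u) \<Longrightarrow> (\<And>x. x \<in> carrier G \<Longrightarrow> \<bar>u x\<bar> \<le> \<delta>) \<Longrightarrow>
        1 \<le> K * energy G S p u * \<delta> powr \<eta>"
proof -
  \<comment> \<open>Half of the largest \<open>\<eta>\<close> for which \<open>D\<sigma> \<ge> p\<close>, so that the inequality becomes strict.\<close>
  define \<eta> where "\<eta> = (D * (q - p) - p * q) / (2 * D)"
  define \<sigma> where "\<sigma> = (q - p - \<eta>) / q"
  have \<eta>: "\<eta> > 0" using q D by (simp add: \<eta>_def)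
  have "D * \<sigma> = (D * (q - p) + p * q) / (2 * q)"
    using D q(1) by (simp add: \<sigma>_def \<eta>_def field_simps)
  also have "\<dots> > p" using q by (simp add: pos_less_divide_eq)
  finally have \<sigma>D: "p < D * \<sigma>" .
  then have \<sigma>: "\<sigma> > 0" using p D by (smt (verit) mult_nonneg_nonpos)
  define b where "b = 2 powr D"
  have b: "b > 1" using D powr_less_mono[of 0 D 2] by (simp add: b_def)
  have bk: "real (2 ^ k) powr D = b ^ k" for k
    using powr_powr_swap[of 2 D "real k"] by (simp add: b_def powr_realpow)
  \<comment> \<open>The 1 serves the points with \<open>k = 0\<close>, where minimality says nothing but \<open>|u| \<le> 1\<close> suffices.\<close>
  define A where "A = max 1 (2 * 2 powr q * b / C)"
  have A: "A > 0" by (simp add: A_def)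
  define \<rho> where "\<rho> = 2 powr p / b powr \<sigma>"
  have \<rho>: "0 < \<rho>" "\<rho> < 1"
    using \<sigma>D powr_less_mono[of p "D * \<sigma>" 2] by (auto simp: \<rho>_def b_def powr_powr)
  define K where "K = A powr \<sigma> * (2 * 2 powr p) / (1 - \<rho>)"
  have K: "K \<ge> 0" using \<rho> by (simp add: K_def)
  have "1 \<le> K * energy G S p u * \<delta> powr \<eta>"
    if N: "power_summable q (carrier G) u" "power_sum q (carrier G) u = 1"
      and E: "power_summable p (edges G S) (grad u)"
      and \<delta>: "\<And>x. x \<in> carrier G \<Longrightarrow> \<bar>u x\<bar> \<le> \<delta>" for u \<delta>
  proof -
    have u1: "\<bar>u x\<bar> powr q \<le> 1" if "x \<in> carrier G" for x
      using finite_sum_le_power_sum[OF N(1), of "{x}"] N(2) that by simp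
    \<comment> \<open>The logarithm of the radius assigned to \<open>x\<close>; \<open>b ^ k\<close> is the \<open>D\<close>-th power of \<open>2 ^ k\<close>.\<close>
    define k where "k x = (LEAST k. 2 * (2 / \<bar>u x\<bar>) powr q \<le> C * b ^ k)" for x
    have k1: "2 * (2 / \<bar>u x\<bar>) powr q \<le> C * b ^ k x" for x
    proof -
      obtain n where "2 * (2 / \<bar>u x\<bar>) powr q / C < b ^ n" using real_arch_pow[OF b] by blast
      then have "2 * (2 / \<bar>u x\<bar>) powr q \<le> C * b ^ n" using C by (simp add: field_simps)
      then show ?thesis unfolding k_def by (rule LeastI)
    qed
    have k2: "\<bar>u x\<bar> powr q \<le> A / b ^ k x" if x: "x \<in> carrier G" "u x \<noteq> 0" for x
    proof (cases "k x")
      case 0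
      then show ?thesis using u1[OF x(1)] by (simp add: A_def)
    next
      case (Suc m)
      then have "\<not> 2 * (2 / \<bar>u x\<bar>) powr q \<le> C * b ^ m"
        unfolding k_def by (intro not_less_Least) simp
      then have "C * b ^ m < 2 * 2 powr q / \<bar>u x\<bar> powr q" by (simp add: powr_divide)
      then have "\<bar>u x\<bar> powr q < 2 * 2 powr q / (C * b ^ m)"
        using x(2) C b by (simp add: field_simps)
      also have "\<dots> = (2 * 2 powr q * b / C) / b ^ k x" using b by (simp add: Suc)
      also have "\<dots> \<le> A / b ^ k x" using b by (intro divide_right_mono) (auto simp: A_def)
      finally show ?thesis by simp
    qed
    let ?E = "energy G S p u"
    have E0: "0 \<le> ?E" by (rule power_sum_nonneg)
    have fin: "(\<Sum>x\<in>F. \<bar>u x\<bar> powr q) \<le> K * ?E * \<delta> powr \<eta>"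
      if F: "finite F" "F \<subseteq> carrier G" and nz: "\<And>x. x \<in> F \<Longrightarrow> u x \<noteq> 0" for F
    proof -
      have level: "(\<Sum>x\<in>{x \<in> F. k x = n}. \<bar>u x\<bar> powr q)
          \<le> \<delta> powr \<eta> * A powr \<sigma> * (2 * 2 powr p) * ?E * \<rho> ^ n" for n
      proof -
        have "\<bar>u x\<bar> powr q \<le> \<delta> powr \<eta> * (A / b ^ n) powr \<sigma> * \<bar>u x\<bar> powr p"
          if "x \<in> {x \<in> F. k x = n}" for x
        proof -
          have x: "x \<in> carrier G" "u x \<noteq> 0" "k x = n" using that F nz by auto
          have "\<bar>u x\<bar> powr q = \<bar>u x\<bar> powr \<eta> * (\<bar>u x\<bar> powr q) powr \<sigma> * \<bar>u x\<bar> powr p"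
            using q(1) by (simp add: powr_powr \<sigma>_def flip: powr_add)
          also have "\<dots> \<le> \<delta> powr \<eta> * (A / b ^ n) powr \<sigma> * \<bar>u x\<bar> powr p"
            using \<delta>[OF x(1)] k2[OF x(1,2)] x(3) \<eta> \<sigma>
            by (intro mult_right_mono mult_mono powr_mono2) auto
          finally show ?thesis .
        qed
        then have "(\<Sum>x\<in>{x \<in> F. k x = n}. \<bar>u x\<bar> powr q)
            \<le> (\<Sum>x\<in>{x \<in> F. k x = n}. \<delta> powr \<eta> * (A / b ^ n) powr \<sigma> * \<bar>u x\<bar> powr p)"
          by (rule sum_mono)
        also have "\<dots> = \<delta> powr \<eta> * (A / b ^ n) powr \<sigma> * (\<Sum>x\<in>{x \<in> F. k x = n}. \<bar>u x\<bar> powr p)"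
          by (simp add: sum_distrib_left)
        also have "\<dots> \<le> \<delta> powr \<eta> * (A / b ^ n) powr \<sigma> *
            (2 * 2 powr p * (real (2 ^ n) powr p * ?E))"
        proof (intro mult_left_mono sum_powr_le_if_ball_large[OF p _ N E])
          fix x assume "x \<in> {x \<in> F. k x = n}"
          then have "u x \<noteq> 0" "2 * (2 / \<bar>u x\<bar>) powr q \<le> C * b ^ n"
            using nz k1[of x] by auto
          then show "u x \<noteq> 0 \<and> 2 * (2 / \<bar>u x\<bar>) powr q \<le> real (growth G S (2 ^ n))"
            using growth[of "2 ^ n"] bk[of n] by auto
        qed (use F q in auto)
        also have "\<dots> = \<delta> powr \<eta> * A powr \<sigma> * (2 * 2 powr p) * ?E * \<rho> ^ n"
        proof -
          have "real (2 ^ n) powr p = (2 powr p) ^ n"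
            using powr_powr_swap[of 2 p "real n"] by (simp add: powr_realpow)
          moreover have "(b ^ n) powr \<sigma> = (b powr \<sigma>) ^ n"
            using powr_powr_swap[of b \<sigma> "real n"] b by (simp add: powr_realpow)
          ultimately show ?thesis using A b by (simp add: \<rho>_def powr_divide power_divide)
        qed
        finally show ?thesis .
      qed
      have "(\<Sum>x\<in>F. \<bar>u x\<bar> powr q) = (\<Sum>n\<in>k ` F. \<Sum>x\<in>{x \<in> F. k x = n}. \<bar>u x\<bar> powr q)"
        by (rule sum.image_gen[OF F(1)])
      also have "\<dots> \<le> (\<Sum>n\<in>k ` F. \<delta> powr \<eta> * A powr \<sigma> * (2 * 2 powr p) * ?E * \<rho> ^ n)"
        by (intro sum_mono level)
      also have "\<dots> = \<delta> powr \<eta> * A powr \<sigma> * (2 * 2 powr p) * ?E * (\<Sum>n\<in>k ` F. \<rho> ^ n)"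
        by (simp only: sum_distrib_left)
      also have "\<dots> \<le> \<delta> powr \<eta> * A powr \<sigma> * (2 * 2 powr p) * ?E * (1 / (1 - \<rho>))"
      proof (intro mult_left_mono)
        have "(\<Sum>n\<in>k ` F. \<rho> ^ n) \<le> (\<Sum>n. \<rho> ^ n)"
          using F(1) \<rho> by (intro sum_le_suminf) (auto intro: summable_geometric)
        then show "(\<Sum>n\<in>k ` F. \<rho> ^ n) \<le> 1 / (1 - \<rho>)"
          using \<rho> by (simp add: suminf_geometric)
      qed (use E0 in auto)
      also have "\<dots> = K * ?E * \<delta> powr \<eta>" by (simp add: K_def)
      finally show ?thesis .
    qed
    have "power_sum q (carrier G) u \<le> K * ?E * \<delta> powr \<eta>"
    proof (rule power_sum_bounded(2))
      fix F assume F: "finite F" "F \<subseteq> carrier G"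
      have "(\<Sum>x\<in>F. \<bar>u x\<bar> powr q) = (\<Sum>x\<in>{x \<in> F. u x \<noteq> 0}. \<bar>u x\<bar> powr q)"
        using F(1) by (intro sum.mono_neutral_right) auto
      also have "\<dots> \<le> K * ?E * \<delta> powr \<eta>" using F by (intro fin) auto
      finally show "(\<Sum>x\<in>F. \<bar>u x\<bar> powr q) \<le> K * ?E * \<delta> powr \<eta>" .
    qed
    then show ?thesis using N(2) by simp
  qed
  then show thesis using that K \<eta> by blast
qed

end

section \<open>Compactness of minimizing sequences\<close>

text \<open>
  Strict subadditivity of \<open>t \<mapsto> t\<^sup>s\<close> for \<open>s < 1\<close>: splitting the mass between two pieces is too expensive.
\<close>
lemma powr_sum_le_1_imp_eq_1:
  fixes a s :: real
  assumes a: "0 < a" "a \<le> 1" and s: "s < 1" and le: "(1 - a) powr s + a powr s \<le> 1"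
  shows "a = 1"
proof (rule ccontr)
  assume "a \<noteq> 1"
  then have "a < 1" using a by simp
  have gt: "t < t powr s" if "0 < t" "t < 1" for t :: real
    using powr_less_mono'[of t s 1] that s by simp
  show False using gt[of a] gt[of "1 - a"] a \<open>a < 1\<close> le by auto
qed

context cayley_graph
begin

lemma countable_carrier: "countable (carrier G)"
proof (rule countable_subset)
  show "carrier G \<subseteq> (\<lambda>ws. foldr (\<otimes>) ws \<one>) ` lists (sym_gens G S)"
    using exists_word by (auto simp: image_iff lists_eq_set)
  show "countable ((\<lambda>ws. foldr (\<otimes>) ws \<one>) ` lists (sym_gens G S))"
    using finite_gens by (intro countable_image countable_lists countable_finite) (simp add: sym_gens_def)
qed

lemma lq_norm_eq_1_iff:
  assumes q: "0 < q"
  shows "lq_norm G q u = 1 \<longleftrightarrow> power_summable q (carrier G) u \<and> power_sum q (carrier G) u = 1"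
proof
  assume 1: "lq_norm G q u = 1"
  have "power_sum q (carrier G) u = (power_sum q (carrier G) u powr (1 / q)) powr q"
    using q by (simp add: powr_powr power_sum_nonneg)
  also have "\<dots> = 1" using 1 by (simp add: lq_norm_def)
  finally show "power_summable q (carrier G) u \<and> power_sum q (carrier G) u = 1"
    using lq_norm_eq_1_imp_summable[OF 1] by simp
next
  assume "power_summable q (carrier G) u \<and> power_sum q (carrier G) u = 1"
  then show "lq_norm G q u = 1" by (simp add: lq_norm_def)
qed

lemma D1p_norm_powr:
  assumes p: "1 \<le> p" and "u \<in> D1p G S p"
  shows "D1p_norm G S p u powr p = energy G S p u"
  using p by (simp add: D1p_norm_eq[OF D1p_finite_energy[OF assms(2) p]] powr_powr power_sum_nonneg)

text \<open>
  The energy and the \<open>q\<close>-sum scale with exponents \<open>p\<close> and \<open>q\<close>, so the infimum over normalized functions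
  is the best constant in an inequality for all functions.
\<close>
lemma sobolev_inf_le:
  assumes p: "1 \<le> p" and q: "0 < q"
    and N: "power_summable q (carrier G) u" and E: "power_summable p (edges G S) (grad u)"
  shows "sobolev_inf G S p q * power_sum q (carrier G) u powr (p / q) \<le> energy G S p u"
proof (cases "power_sum q (carrier G) u = 0")
  case True
  then show ?thesis by (simp add: power_sum_nonneg)
next
  case False
  define a where "a = power_sum q (carrier G) u"
  have a: "a > 0" using False power_sum_nonneg[where p = q and A = "carrier G" and f = u] by (simp add: a_def)
  define t where "t = a powr (- 1 / q)"
  have t: "t > 0" using a by (simp add: t_def)
  have tq: "t powr q = 1 / a" "t powr p = 1 / a powr (p / q)"
  proof -
    have "t powr q = a powr (- 1)" "t powr p = a powr (- (p / q))"
      unfolding t_def powr_powr using q by simp_all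
    then show "t powr q = 1 / a" "t powr p = 1 / a powr (p / q)"
      using a by (simp_all only: powr_minus_divide powr_one_gt_zero_iff less_imp_le simp_thms powr_one)
  qed
  define w where "w x = t * u x" for x
  have wq: "\<bar>w x\<bar> powr q = t powr q * \<bar>u x\<bar> powr q" for x
    using t by (simp add: w_def abs_mult powr_mult)
  have wN: "power_summable q (carrier G) w"
    unfolding wq by (rule summable_on_cmult_right[OF N])
  have wN1: "power_sum q (carrier G) w = 1"
    unfolding wq infsum_cmult_right' a_def[symmetric] tq(1) using a by simp
  have wp: "\<bar>grad w e\<bar> powr p = t powr p * \<bar>grad u e\<bar> powr p" for e
    using t by (cases e) (simp add: w_def grad_def abs_mult powr_mult flip: right_diff_distrib)
  have wE: "power_summable p (edges G S) (grad w)"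
    unfolding wp by (rule summable_on_cmult_right[OF E])
  have wE1: "energy G S p w = t powr p * energy G S p u"
    unfolding wp by (rule infsum_cmult_right')
  have w: "w \<in> D1p G S p"
    using in_D1p_if_power_summable[OF p _ wE wN] q by simp
  have "sobolev_inf G S p q \<le> D1p_norm G S p w powr p"
    unfolding sobolev_inf_def
  proof (rule cInf_lower)
    show "D1p_norm G S p w powr p \<in> {D1p_norm G S p u powr p |u. u \<in> D1p G S p \<and> lq_norm G q u = 1}"
      using w wN wN1 lq_norm_eq_1_iff[OF q] by blast
    show "bdd_below {D1p_norm G S p u powr p |u. u \<in> D1p G S p \<and> lq_norm G q u = 1}"
      by (rule bdd_belowI[of _ 0]) auto
  qed
  then show ?thesis
    using a by (simp add: D1p_norm_powr[OF p w] wE1 tq(2) a_def field_simps)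
qed

text \<open>
  Splitting off the pointwise limit: the exclusion of vanishing (\<open>sup_norm_lower_bound\<close>) makes the
  limit nonzero, and strict subadditivity then excludes that mass stays behind in the remainder.
\<close>
theorem minimizing_sequence_compact:
  fixes C D p q :: real and u :: "nat \<Rightarrow> 'a \<Rightarrow> real"
  assumes C: "0 < C" and D: "0 < D"
    and growth: "\<And>r. 1 \<le> r \<Longrightarrow> C * real r powr D \<le> real (growth G S r)"
    and p: "1 \<le> p" and q: "p < q" "p * q < D * (q - p)"
    and u: "is_minimizing_seq G S p q u"
  shows "\<exists>g. (\<forall>n. g n \<in> carrier G) \<and>
           (\<exists>(r :: nat \<Rightarrow> nat) v. strict_mono r \<and>
              converges_in_D1p G S p (\<lambda>k x. u (r k) (g (r k) \<otimes> x)) v \<and>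
              is_minimizer G S p q v)"
proof -
  have q0: "0 < q" using p q by simp
  let ?I = "sobolev_inf G S p q"
  have uD: "u n \<in> D1p G S p" and u1: "lq_norm G q (u n) = 1"
    and ulim: "(\<lambda>n. D1p_norm G S p (u n) powr p) \<longlonglongrightarrow> ?I" for n
    using u by (auto simp: is_minimizing_seq_def)
  have uN: "power_summable q (carrier G) (u n)" "power_sum q (carrier G) (u n) = 1" for n
    using u1[of n] lq_norm_eq_1_iff[OF q0] by auto
  have uE: "power_summable p (edges G S) (grad (u n))" for n
    by (rule D1p_finite_energy[OF uD p])
  have uElim: "(\<lambda>n. energy G S p (u n)) \<longlonglongrightarrow> ?I"
    using ulim by (simp add: D1p_norm_powr[OF p uD])
  then have "Bseq (\<lambda>n. energy G S p (u n))"
    by (intro convergent_imp_Bseq convergentI)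
  then obtain M where "\<And>n. norm (energy G S p (u n)) \<le> M"
    unfolding Bseq_def by blast
  then have M: "energy G S p (u n) \<le> M" for n
    using abs_le_D1[of "energy G S p (u n)" M] by (simp only: real_norm_def)
  obtain K \<eta> where K: "0 \<le> K" "0 < \<eta>"
    "\<And>u \<delta>. power_summable q (carrier G) u \<Longrightarrow> power_sum q (carrier G) u = 1 \<Longrightarrow>
        power_summable p (edges G S) (grad u) \<Longrightarrow> (\<And>x. x \<in> carrier G \<Longrightarrow> \<bar>u x\<bar> \<le> \<delta>) \<Longrightarrow>
        1 \<le> K * energy G S p u * \<delta> powr \<eta>"
    using sup_norm_lower_bound[OF C D growth p q0 q(2)] by blast
  have le1: "\<bar>w x\<bar> \<le> 1"
    if "power_summable q (carrier G) w" "power_sum q (carrier G) w = 1" "x \<in> carrier G" for w x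
  proof -
    have "\<bar>w x\<bar> powr q \<le> 1"
      using finite_sum_le_power_sum[OF that(1), of "{x}"] that by simp
    moreover have "1 powr q < \<bar>w x\<bar> powr q" if "\<not> \<bar>w x\<bar> \<le> 1"
      using that q0 by (intro powr_less_mono2) auto
    ultimately show ?thesis by force
  qed
  \<comment> \<open>The infimum is positive: the lower bound applies with \<open>\<delta> = 1\<close>, as normalized functions are
    bounded by 1.\<close>
  have Ipos: "0 < ?I"
  proof -
    have low: "1 \<le> K * energy G S p w"
      if "power_summable q (carrier G) w" "power_sum q (carrier G) w = 1"
        "power_summable p (edges G S) (grad w)" for w
      using K(3)[OF that, of 1] le1[OF that(1,2)] by simp
    have K0: "0 < K" using low[OF uN uE] K(1) by (cases "K = 0") auto
    have "1 / K \<le> ?I"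
      unfolding sobolev_inf_def
    proof (rule cInf_greatest)
      show "{D1p_norm G S p u powr p |u. u \<in> D1p G S p \<and> lq_norm G q u = 1} \<noteq> {}"
        using uD u1 by blast
      fix y assume "y \<in> {D1p_norm G S p u powr p |u. u \<in> D1p G S p \<and> lq_norm G q u = 1}"
      then obtain w where w: "w \<in> D1p G S p" "lq_norm G q w = 1" "y = D1p_norm G S p w powr p" by blast
      have "1 \<le> K * energy G S p w"
        using low D1p_finite_energy[OF w(1) p] w(2) lq_norm_eq_1_iff[OF q0] by blast
      then show "1 / K \<le> y" using K0 by (simp add: w(3) D1p_norm_powr[OF p w(1)] field_simps)
    qed
    moreover have "0 < 1 / K" using K0 by simp
    ultimately show ?thesis by linarith
  qed
  \<comment> \<open>Chosen so that \<open>K M \<delta>\<^sup>\<eta> < 1\<close>; a function of the sequence bounded by \<open>\<delta>\<close> would contradict the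
    lower bound.\<close>
  define \<delta> where "\<delta> = (1 / (2 * (K * \<bar>M\<bar> + 1))) powr (1 / \<eta>)"
  have KM: "0 \<le> K * \<bar>M\<bar>" using K(1) by simp
  have \<delta>: "0 < \<delta>" using KM by (simp add: \<delta>_def)
  have "\<exists>x\<in>carrier G. \<delta> < \<bar>u n x\<bar>" for n
  proof (rule ccontr)
    assume "\<not> ?thesis"
    then have "1 \<le> K * energy G S p (u n) * \<delta> powr \<eta>"
      by (intro K(3)[OF uN uE]) force
    also have "\<dots> \<le> K * \<bar>M\<bar> * \<delta> powr \<eta>"
      using M[of n] K(1) by (intro mult_right_mono mult_left_mono) auto
    also have "\<delta> powr \<eta> = 1 / (2 * (K * \<bar>M\<bar> + 1))"
      using K(2) KM by (simp add: \<delta>_def powr_powr)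
    also have "K * \<bar>M\<bar> * (1 / (2 * (K * \<bar>M\<bar> + 1))) < 1"
      using KM by (simp add: pos_divide_less_eq)
    finally show False by simp
  qed
  then obtain g where g: "\<And>n. g n \<in> carrier G" "\<And>n. \<delta> < \<bar>u n (g n)\<bar>" by metis
  define w where "w n x = u n (g n \<otimes> x)" for n x
  have wN: "power_summable q (carrier G) (w n)" "power_sum q (carrier G) (w n) = 1"
    and wE: "power_summable p (edges G S) (grad (w n))" "energy G S p (w n) = energy G S p (u n)" for n
    unfolding w_def using translate_power_sum[OF g(1)] translate_energy[OF g(1)] uN uE by simp_all
  obtain r :: "nat \<Rightarrow> nat" where r: "strict_mono r"
    "\<And>x. x \<in> carrier G \<Longrightarrow> \<exists>l. (\<lambda>n. w (r n) x) \<longlonglongrightarrow> l"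
  proof (rule function_convergent_subsequence[OF countable_carrier, of w 1])
    show "norm (w n x) \<le> 1" if "x \<in> carrier G" for n x
      using le1[OF wN that] by simp
  qed blast
  then obtain v where v: "\<And>x. x \<in> carrier G \<Longrightarrow> (\<lambda>n. w (r n) x) \<longlonglongrightarrow> v x" by metis
  have gradlim: "(\<lambda>n. grad (w (r n)) e) \<longlonglongrightarrow> grad v e" if "e \<in> edges G S" for e
    using that by (cases e) (auto simp: grad_def edges_def cayley_adj_def intro!: tendsto_diff v)
  have vN: "power_summable q (carrier G) v" "power_sum q (carrier G) v \<le> 1"
    using power_sum_Fatou[OF q0 v wN(1)] wN(2) by auto
  have vE: "power_summable p (edges G S) (grad v)"
    using power_sum_Fatou(1)[OF _ gradlim wE(1)] M wE(2) p by auto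
  have dN: "power_summable q (carrier G) (\<lambda>x. w (r n) x - v x)" for n
    using power_sum_diff_le(1)[OF _ wN(1) vN(1)] p q by simp
  have dE: "power_summable p (edges G S) (grad (\<lambda>x. w (r n) x - v x))" for n
    using power_sum_diff_le(1)[OF p wE(1) vE] by (simp add: grad_diff)
  define a where "a = power_sum q (carrier G) v"
  define b where "b n = power_sum q (carrier G) (\<lambda>x. w (r n) x - v x)" for n
  define E where "E n = energy G S p (\<lambda>x. w (r n) x - v x)" for n
  have blim: "b \<longlonglongrightarrow> 1 - a"
  proof -
    have "(\<lambda>n. power_sum q (carrier G) (w (r n)) - b n) \<longlonglongrightarrow> a"
      unfolding a_def b_def using p q wN by (intro Brezis_Lieb[where M = 1] v) auto
    then have "(\<lambda>n. 1 - (1 - b n)) \<longlonglongrightarrow> 1 - a"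
      unfolding wN(2) by (intro tendsto_diff tendsto_const)
    then show ?thesis by simp
  qed
  have wlim: "(\<lambda>n. energy G S p (w (r n))) \<longlonglongrightarrow> ?I"
    using LIMSEQ_subseq_LIMSEQ[OF uElim r(1)] by (simp add: wE(2) o_def)
  have Elim: "E \<longlonglongrightarrow> ?I - energy G S p v"
  proof -
    have "(\<lambda>n. energy G S p (w (r n)) - E n) \<longlonglongrightarrow> energy G S p v"
      unfolding E_def grad_diff using M wE by (intro Brezis_Lieb[where M = M] p gradlim) auto
    from tendsto_diff[OF wlim this] show ?thesis by simp
  qed
  have E0: "0 \<le> E n" for n unfolding E_def by (rule power_sum_nonneg)
  \<comment> \<open>Both pieces, \<open>v\<close> and \<open>w\<^sub>n - v\<close>, obey the inequality defining \<open>?I\<close>.\<close>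
  have Sv: "?I * a powr (p / q) \<le> energy G S p v"
    unfolding a_def by (rule sobolev_inf_le[OF p q0 vN(1) vE])
  have "?I * (1 - a) powr (p / q) \<le> ?I - energy G S p v"
  proof (rule LIMSEQ_le[OF _ Elim])
    show "(\<lambda>n. ?I * b n powr (p / q)) \<longlonglongrightarrow> ?I * (1 - a) powr (p / q)"
      using p q0 by (intro tendsto_mult tendsto_const tendsto_powr' blim)
        (auto simp: b_def power_sum_nonneg)
    show "\<exists>N. \<forall>n\<ge>N. ?I * b n powr (p / q) \<le> E n"
      unfolding b_def E_def using sobolev_inf_le[OF p q0 dN dE] by blast
  qed
  with Sv have "?I * ((1 - a) powr (p / q) + a powr (p / q)) \<le> ?I * 1"
    by (simp add: distrib_left)
  then have le: "(1 - a) powr (p / q) + a powr (p / q) \<le> 1"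
    using Ipos by (simp only: mult_le_cancel_left_pos)
  have a0: "0 < a"
  proof -
    have lim1: "(\<lambda>n. \<bar>w (r n) \<one>\<bar>) \<longlonglongrightarrow> \<bar>v \<one>\<bar>" by (intro tendsto_rabs v) simp
    have "\<delta> \<le> \<bar>v \<one>\<bar>"
      by (rule LIMSEQ_le_const[OF lim1]) (use g in \<open>auto simp: w_def intro!: exI less_imp_le\<close>)
    then have "0 < \<bar>v \<one>\<bar> powr q" using \<delta> by auto
    also have "\<dots> \<le> a"
      unfolding a_def using finite_sum_le_power_sum[OF vN(1), of "{\<one>}"] by simp
    finally show ?thesis .
  qed
  have a1: "a = 1"
    by (rule powr_sum_le_1_imp_eq_1[OF a0 _ _ le]) (use vN(2) p q in \<open>auto simp: a_def\<close>)
  \<comment> \<open>Now \<open>v\<close> is itself a competitor, so its energy is at least \<open>?I\<close>; the remainder has nonnegative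
    energy, so it is also at most \<open>?I\<close>.\<close>
  have "0 \<le> ?I - energy G S p v"
    by (rule LIMSEQ_le_const[OF Elim]) (use E0 in auto)
  with Sv a1 have vI: "energy G S p v = ?I" by simp
  have vD: "v \<in> D1p G S p"
    using in_D1p_if_power_summable[OF p _ vE vN(1)] q0 by simp
  have "(\<lambda>n. E n powr (1 / p)) \<longlonglongrightarrow> 0 powr (1 / p)"
    using Elim p E0 unfolding vI by (intro tendsto_powr') auto
  then have "(\<lambda>n. D1p_norm G S p (\<lambda>x. w (r n) x - v x)) \<longlonglongrightarrow> 0"
    unfolding E_def using p by (simp add: D1p_norm_eq[OF dE])
  moreover have "w n \<in> D1p G S p" for n
    using in_D1p_if_power_summable[OF p _ wE(1) wN(1)] q0 by simp
  ultimately have "converges_in_D1p G S p (\<lambda>k. w (r k)) v"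
    using vD by (simp add: converges_in_D1p_def)
  moreover have "is_minimizer G S p q v"
    using vD vI vN(1) a1 lq_norm_eq_1_iff[OF q0]
    by (simp add: is_minimizer_def D1p_norm_powr[OF p vD] a_def)
  ultimately show ?thesis
    using g(1) r(1) unfolding w_def[abs_def] by blast
qed

end

theorem theorem2:
  fixes G :: "('a, 'b) monoid_scheme" and S :: "'a set"
    and D C p q :: real and u :: "nat \<Rightarrow> 'a \<Rightarrow> real"
  assumes "group G"
    and "finite S" and "S \<subseteq> carrier G" and "generate G S = carrier G"
    and "D \<ge> 3" and "C > 0"
    and "\<forall>r::nat. r \<ge> 1 \<longrightarrow> real (growth G S r) \<ge> C * real r powr D"
    and "1 \<le> p" and "p < D" and "q > D * p / (D - p)"
    and "is_minimizing_seq G S p q u"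
  shows "\<exists>g :: nat \<Rightarrow> 'a. (\<forall>n. g n \<in> carrier G) \<and>
           (\<exists>(r :: nat \<Rightarrow> nat) v. strict_mono r \<and>
              converges_in_D1p G S p (\<lambda>k x. u (r k) (g (r k) \<otimes>\<^bsub>G\<^esub> x)) v \<and>
              is_minimizer G S p q v)"
proof -
  interpret cayley_graph G S
    using assms(1-4) by (simp add: cayley_graph_def cayley_graph_axioms_def)
  have gap: "p * q < D * (q - p)"
    using assms(9,10) by (simp add: pos_divide_less_eq algebra_simps)
  have "0 < D * (q - p)"
  proof (rule ccontr)
    assume "\<not> ?thesis"
    then have "q \<le> p" using assms(8,9) by (simp add: zero_less_mult_iff)
    moreover have "p \<le> D * p / (D - p)" using assms(8,9) by (simp add: pos_le_divide_eq algebra_simps)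
    ultimately show False using assms(10) by simp
  qed
  then have "p < q" using assms(8,9) by (simp add: zero_less_mult_iff)
  then show ?thesis
    using minimizing_sequence_compact[OF assms(6) _ _ assms(8) _ gap assms(11)] assms by auto
qed

end
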